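(* Let $\mathcal{V}=\mathcal{C}_{N,k}$ be the approximation space and $\mathcal{W}=\mathcal{C}_{N,2k}$ the double-grid space, with $V=\dim\mathcal{V}$. Let $m:\Omega\to\mathbb{R}$ be a uniformly positive integrable function, and let $\mathsf{A}\in\mathbb{R}^{V\times V}$ be the system matrix of the weighted projection, $$\mathsf{A}_{ij}=\int_\Omega m(x)\,\phi_{\mathcal{V}}^j(x)\,\phi_{\mathcal{V}}^i(x)\,dx.$$ For each element $T\in\mathcal{M}$ define $\mathsf{A}_T^{\mathrm{DoGIP}}\in\mathbb{R}^{W_T\times W_T}$, and define $\hat{\mathsf{B}}\in\mathbb{R}^{W_T\times V_T}$ (independent of $T$), by $$\mathsf{A}^{\mathrm{DoGIP}}_{T,ij}=\delta_{ij}\int_T m(x)\,\phi_{\mathcal{W}}^{l_T^{\mathcal{W}}(j)}(x)\,dx,\qquad \hat{\mathsf{B}}_{jl}=\hat\phi_{\mathcal{V}}^l(\hat x_{\mathcal{W}}^j).$$ Then for all $\mathsf{u},\mathsf{v}\in\mathbb{R}^V$, $$\mathsf{A}\mathsf{u}\cdot\mathsf{v}=\sum_{T\in\mathcal{M}}\hat{\mathsf{B}}^*\mathsf{A}_T^{\mathrm{DoGIP}}\hat{\mathsf{B}}\,\mathsf{u}_T\cdot\mathsf{v}_T=\sum_{T\in\mathcal{M}}\sum_{i,j=1}^{W_T}\sum_{k,l=1}^{V_T}\mathsf{A}^{\mathrm{DoGIP}}_{T,ij}\,\hat{\mathsf{B}}_{jl}\,\mathsf{u}_{T,l}\,\hat{\mathsf{B}}_{ik}\,\mathsf{v}_{T,k},$$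 where $\mathsf{u}_T=(\mathsf{u}_{l_T^{\mathcal{V}}(l)})_{l=1}^{V_T}$ and $\mathsf{v}_T=(\mathsf{v}_{l_T^{\mathcal{V}}(k)})_{k=1}^{V_T}$ are the local degrees of freedom on $T$ (in the last sum $k$ denotes a summation index, not the polynomial order).
   Context: $\Omega\subset\mathbb{R}^d$ ($d=2$ or $3$) is a bounded open set with a finite mesh $\mathcal{M}=\mathcal{M}(\Omega)$ of non-overlapping simplexes $T$ (triangles or tetrahedra) covering $\Omega$, with no hanging nodes (a conforming simplicial mesh). The subscript $N$ is the discretisation parameter of the mesh. $\mathcal{P}_k$ is the space of real polynomials on $\mathbb{R}^d$ of total degree at most $k$, and $k\ge1$ is an integer. For an integer $\ell\ge1$, $$\mathcal{C}_{N,\ell}=\{v:\Omega\to\mathbb{R}\mid v|_T\in\mathcal{P}_\ell\ \ \forall T\in\mathcal{M},\ v\text{ continuous}\}.$$ Functions in $\mathcal{C}_{N,\ell}$ are evaluated at points of $\partial\Omega$ by continuous extension from elements. Each such space $\mathcal{X}=\mathcal{C}_{N,\ell}$ is equipped with its standard Lagrange finite element basis $\phi_{\mathcal{X}}^i$ and nodal points $x_{\mathcal{X}}^i$, $i=1,\dots,\dim\mathcal{X}$, with $\phi_{\mathcal{X}}^j(x_{\mathcal{X}}^i)=\delta_{ij}$. Reference element: each $T$ is the image of a fixed reference simplex $\hat T$ under an affine map $F_T(\hat x)=R_T\hat x+S_T$ with $R_T\in\mathbb{R}^{d\times d}$ invertible and $S_T\in\mathbb{R}^d$. For $\mathcal{X}=\mathcal{C}_{N,\ell}$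 let $X_T=\dim\mathcal{P}_\ell$ (so $V_T=\dim\mathcal{P}_k$ and $W_T=\dim\mathcal{P}_{2k}$). On $\hat T$ there are reference Lagrange shape functions $\hat\phi_{\mathcal{X}}^1,\dots,\hat\phi_{\mathcal{X}}^{X_T}$ forming a basis of $\mathcal{P}_\ell$ and reference nodes $\hat x_{\mathcal{X}}^1,\dots,\hat x_{\mathcal{X}}^{X_T}$ with $\hat\phi_{\mathcal{X}}^j(\hat x_{\mathcal{X}}^i)=\delta_{ij}$. For each $T$ there is an injective local-to-global index map $l_T^{\mathcal{X}}:\{1,\dots,X_T\}\to\{1,\dots,\dim\mathcal{X}\}$ such that $\phi_{\mathcal{X}}^{l_T^{\mathcal{X}}(i)}(x)=\hat\phi_{\mathcal{X}}^i(F_T^{-1}(x))$ for $x\in T$ and $x_{\mathcal{X}}^{l_T^{\mathcal{X}}(i)}=F_T(\hat x_{\mathcal{X}}^i)$, while global basis functions with index outside the range of $l_T^{\mathcal{X}}$ vanish on $T$. "Uniformly positive" means bounded below by a positive constant. $*$ denotes the adjoint (transpose), and $\cdot$ the Euclidean inner product. *)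

theory Defs
  imports "HOL-Analysis.Analysis" "HOL-Library.Function_Algebras" "Jordan_Normal_Form.Matrix"
begin

unbundle no inner_syntax

text \<open>Points of space have type \<^typ>\<open>real ^ 'd\<close>; coefficient vectors and matrices, whose sizes
  are dimensions of finite element spaces, are those of \<^theory>\<open>Jordan_Normal_Form.Matrix\<close>.
  All enumerations start from 0.\<close>

instantiation "fun" :: (type, real_vector) real_vector
begin

definition scaleR_fun :: "real \<Rightarrow> ('a \<Rightarrow> 'b) \<Rightarrow> 'a \<Rightarrow> 'b" where
  "scaleR_fun c f = (\<lambda>x. c *\<^sub>R f x)"

instance
  by standard (simp_all add: scaleR_fun_def fun_eq_iff scaleR_add_right scaleR_add_left)

end

definition polys :: "nat \<Rightarrow> (real ^ 'd \<Rightarrow> real) set" where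
  "polys r = span {(\<lambda>x. \<Prod>i\<in>UNIV. vec_nth x i ^ \<alpha> i) | \<alpha>. (\<Sum>i\<in>UNIV. \<alpha> i) \<le> r}"

text \<open>Elements are closed simplexes; that any two meet in a common face (no hanging nodes) is part of
  \<^const>\<open>triangulation\<close>, and implies that distinct elements do not overlap.\<close>

definition simplicial_mesh :: "(real ^ 'd) set \<Rightarrow> (real ^ 'd) set set \<Rightarrow> bool" where
  "simplicial_mesh \<Omega> \<M> \<longleftrightarrow>
     triangulation \<M> \<and>
     (\<forall>T\<in>\<M>. int CARD('d) simplex T \<and> interior T \<subseteq> \<Omega>) \<and>
     \<Union>\<M> = closure \<Omega>"

text \<open>A function on \<open>\<Omega>\<close> is represented by its extension by 0 to the whole space, so that the
  functions on \<open>\<Omega>\<close> form a vector space of the right dimension.\<close>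

definition fe_space ::
  "(real ^ 'd) set \<Rightarrow> (real ^ 'd) set set \<Rightarrow> nat \<Rightarrow> (real ^ 'd \<Rightarrow> real) set" where
  "fe_space \<Omega> \<M> r = {v. (\<forall>T\<in>\<M>. \<exists>p\<in>polys r. \<forall>x\<in>T \<inter> \<Omega>. v x = p x) \<and>
     continuous_on \<Omega> v \<and> (\<forall>x. x \<notin> \<Omega> \<longrightarrow> v x = 0)}"

text \<open>Evaluation on a closed element; at points of \<open>\<partial>\<Omega>\<close> by continuous extension from that element.
  (For domains lying on both sides of a part of their boundary, the extensions from two elements may
  differ.)\<close>

definition elem_val ::
  "(real ^ 'd) set \<Rightarrow> (real ^ 'd) set \<Rightarrow> (real ^ 'd \<Rightarrow> real) \<Rightarrow> real ^ 'd \<Rightarrow> real" where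
  "elem_val \<Omega> T v x = (if x \<in> \<Omega> then v x else Lim (at x within T \<inter> \<Omega>) v)"

definition indexed_basis :: "nat \<Rightarrow> (nat \<Rightarrow> 'v::real_vector) \<Rightarrow> 'v set \<Rightarrow> bool" where
  "indexed_basis n b X \<longleftrightarrow>
     inj_on b {..<n} \<and> independent (b ` {..<n}) \<and> span (b ` {..<n}) = X"

definition elem_map ::
  "((real ^ 'd) set \<Rightarrow> real ^ 'd ^ 'd) \<Rightarrow> ((real ^ 'd) set \<Rightarrow> real ^ 'd) \<Rightarrow>
   (real ^ 'd) set \<Rightarrow> real ^ 'd \<Rightarrow> real ^ 'd" where
  "elem_map R S T \<xi> = R T *v \<xi> + S T"

definition reference_maps ::
  "(real ^ 'd) set set \<Rightarrow> (real ^ 'd) set \<Rightarrow>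
   ((real ^ 'd) set \<Rightarrow> real ^ 'd ^ 'd) \<Rightarrow> ((real ^ 'd) set \<Rightarrow> real ^ 'd) \<Rightarrow> bool" where
  "reference_maps \<M> K R S \<longleftrightarrow>
     int CARD('d) simplex K \<and> (\<forall>T\<in>\<M>. invertible (R T) \<and> elem_map R S T ` K = T)"

definition reference_lagrange ::
  "(real ^ 'd) set \<Rightarrow> nat \<Rightarrow> (nat \<Rightarrow> real ^ 'd \<Rightarrow> real) \<Rightarrow> (nat \<Rightarrow> real ^ 'd) \<Rightarrow> bool" where
  "reference_lagrange K r \<psi> \<xi> \<longleftrightarrow>
     indexed_basis (dim (polys r :: (real ^ 'd \<Rightarrow> real) set)) \<psi> (polys r) \<and>
     (\<forall>i < dim (polys r :: (real ^ 'd \<Rightarrow> real) set). \<xi> i \<in> K) \<and>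
     (\<forall>i < dim (polys r :: (real ^ 'd \<Rightarrow> real) set).
      \<forall>j < dim (polys r :: (real ^ 'd \<Rightarrow> real) set). \<psi> j (\<xi> i) = (if i = j then 1 else 0))"

text \<open>Basis functions \<open>\<phi>\<close>, nodes \<open>xn\<close> and local-to-global maps \<open>L T\<close> of the space of order \<open>r\<close>,
  built from the reference shape functions \<open>\<psi>\<close> and reference nodes \<open>\<xi>\<close> on \<open>K\<close>.
  In the condition on \<open>\<phi> j (xn i)\<close>, a node on \<open>\<partial>\<Omega>\<close> is approached from the elements it belongs to;
  each global index belongs to some element, since otherwise \<open>\<phi> i\<close> would vanish on all of them.\<close>

definition lagrange_fe ::
  "(real ^ 'd) set \<Rightarrow> (real ^ 'd) set set \<Rightarrow> (real ^ 'd) set \<Rightarrow>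
   ((real ^ 'd) set \<Rightarrow> real ^ 'd ^ 'd) \<Rightarrow> ((real ^ 'd) set \<Rightarrow> real ^ 'd) \<Rightarrow> nat \<Rightarrow>
   (nat \<Rightarrow> real ^ 'd \<Rightarrow> real) \<Rightarrow> (nat \<Rightarrow> real ^ 'd) \<Rightarrow>
   (nat \<Rightarrow> real ^ 'd \<Rightarrow> real) \<Rightarrow> (nat \<Rightarrow> real ^ 'd) \<Rightarrow> ((real ^ 'd) set \<Rightarrow> nat \<Rightarrow> nat) \<Rightarrow> bool" where
  "lagrange_fe \<Omega> \<M> K R S r \<psi> \<xi> \<phi> xn L \<longleftrightarrow>
     (let N = dim (fe_space \<Omega> \<M> r); n = dim (polys r :: (real ^ 'd \<Rightarrow> real) set) in
       reference_lagrange K r \<psi> \<xi> \<and>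
       indexed_basis N \<phi> (fe_space \<Omega> \<M> r) \<and>
       (\<forall>T\<in>\<M>.
         inj_on (L T) {..<n} \<and> L T ` {..<n} \<subseteq> {..<N} \<and>
         (\<forall>i<n. xn (L T i) = elem_map R S T (\<xi> i)) \<and>
         (\<forall>i \<in> L T ` {..<n}. \<forall>j<N. elem_val \<Omega> T (\<phi> j) (xn i) = (if i = j then 1 else 0)) \<and>
         (\<forall>i<n. \<forall>x\<in>T. elem_val \<Omega> T (\<phi> (L T i)) x = \<psi> i (inv_into UNIV (elem_map R S T) x)) \<and>
         (\<forall>j \<in> {..<N} - L T ` {..<n}. \<forall>x\<in>T. elem_val \<Omega> T (\<phi> j) x = 0)))"

definition system_matrix ::
  "(real ^ 'd) set \<Rightarrow> (real ^ 'd \<Rightarrow> real) \<Rightarrow> nat \<Rightarrow> (nat \<Rightarrow> real ^ 'd \<Rightarrow> real) \<Rightarrow> real mat" where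
  "system_matrix \<Omega> m N \<phi> =
     mat N N (\<lambda>(i, j). LINT x:\<Omega>|lebesgue. m x * \<phi> j x * \<phi> i x)"

text \<open>The part of \<open>T\<close> outside \<open>\<Omega>\<close> lies in the boundary of \<open>T\<close>, a null set.\<close>

definition dogip_matrix ::
  "(real ^ 'd \<Rightarrow> real) \<Rightarrow> nat \<Rightarrow> (nat \<Rightarrow> real ^ 'd \<Rightarrow> real) \<Rightarrow> ((real ^ 'd) set \<Rightarrow> nat \<Rightarrow> nat) \<Rightarrow>
   (real ^ 'd) set \<Rightarrow> real mat" where
  "dogip_matrix m n \<phi> L T =
     mat n n (\<lambda>(i, j). if i = j then (LINT x:T|lebesgue. m x * \<phi> (L T j) x) else 0)"

definition interpolation_matrix ::
  "nat \<Rightarrow> nat \<Rightarrow> (nat \<Rightarrow> real ^ 'd \<Rightarrow> real) \<Rightarrow> (nat \<Rightarrow> real ^ 'd) \<Rightarrow> real mat" where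
  "interpolation_matrix n n' \<psi> \<xi> = mat n n' (\<lambda>(j, l). \<psi> l (\<xi> j))"

definition local_dofs :: "nat \<Rightarrow> ((real ^ 'd) set \<Rightarrow> nat \<Rightarrow> nat) \<Rightarrow> real vec \<Rightarrow> (real ^ 'd) set \<Rightarrow> real vec" where
  "local_dofs n L u T = vec n (\<lambda>l. vec_index u (L T l))"

end

theory Submission
  imports Defs
begin

text \<open>
  The identity is an exact quadrature rule. The product of two functions of the approximation space
  is, on each element, a polynomial of degree at most \<open>2 * k\<close>, so it equals its own Lagrange
  interpolant in the double-grid space: on an element \<open>T\<close>, after pulling back to the reference
  simplex,
  \<open>\<psi>V l * \<psi>V p = (\<Sum>j. \<psi>V l (\<xi>W j) * \<psi>V p (\<xi>W j) * \<psi>W j)\<close>.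
  Multiplying by \<open>m\<close> and integrating over \<open>T\<close> turns the local mass matrix into a sum over the
  double-grid nodes with weights \<open>\<integral> m * \<psi>W j\<close>, which are the diagonal entries of the DoGIP matrix;
  the coefficients are products of two entries of the interpolation matrix. This is
  \<open>element_integral\<close>, and it rests on \<open>polys_mult\<close> and \<open>lagrange_interpolation\<close>.

  Two further ingredients connect the elements with the global matrix. The integral over \<open>\<Omega>\<close> is the
  sum of the integrals over the elements (\<open>mesh_integral\<close>), because distinct elements meet in proper
  faces, which are null sets; splitting the integral needs integrability, which holds because finite
  element functions are bounded (\<open>set_integrable_mult_fe_space\<close>). And on a given element only the
  basis functions with index in the range of the local-to-global map survive, so the double sum over
  global indices collapses to one over local degrees of freedom (\<open>sum_reindex_support\<close>).

  Elements are closed and may leave \<open>\<Omega>\<close> through its boundary. All integrals are therefore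
  taken over \<open>T \<inter> \<Omega>\<close>, where the element-wise values of a basis function are its actual values; finite
  element functions vanish outside \<open>\<Omega>\<close>, so that an integral over \<open>T\<close> involving one has the same value.
\<close>

section \<open>Polynomials and Lagrange interpolation\<close>

text \<open>The product of two monomials is the monomial of the summed exponents; the general case is
  bilinearity, obtained by induction over the span in each factor separately.\<close>

lemma polys_mult:
  assumes "p \<in> polys r" "q \<in> polys s"
  shows "(\<lambda>x. p x * q x) \<in> (polys (r + s) :: (real ^ 'd \<Rightarrow> real) set)"
proof -
  define mon :: "('d \<Rightarrow> nat) \<Rightarrow> real ^ 'd \<Rightarrow> real"
    where "mon \<alpha> = (\<lambda>x. \<Prod>i\<in>UNIV. vec_nth x i ^ \<alpha> i)" for \<alpha>
  have polys: "polys t = span {mon \<alpha> | \<alpha>. sum \<alpha> UNIV \<le> t}" for t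
    by (simp add: polys_def mon_def)
  have add: "(\<lambda>x. a x + b x) \<in> polys t" if "a \<in> polys t" "b \<in> polys t" for a b :: "real ^ 'd \<Rightarrow> real" and t
    using span_add[OF that[unfolded polys]] by (simp only: polys plus_fun_def)
  have scale: "(\<lambda>x. c * a x) \<in> polys t" if "a \<in> polys t" for a :: "real ^ 'd \<Rightarrow> real" and c t
    using span_scale[OF that[unfolded polys], of c] by (simp only: polys scaleR_fun_def real_scaleR_def)
  have zero: "(\<lambda>x. 0) \<in> (polys t :: (real ^ 'd \<Rightarrow> real) set)" for t
    using span_zero[of "{mon \<alpha> | \<alpha>. sum \<alpha> UNIV \<le> t}"] by (simp only: polys zero_fun_def)
  have mon_mon: "(\<lambda>x. mon \<alpha> x * mon \<beta> x) \<in> polys (r + s)"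
    if "sum \<alpha> UNIV \<le> r" "sum \<beta> UNIV \<le> s" for \<alpha> \<beta>
  proof -
    have "(\<lambda>x. mon \<alpha> x * mon \<beta> x) = mon (\<lambda>i. \<alpha> i + \<beta> i)"
      by (simp add: mon_def fun_eq_iff power_add prod.distrib)
    moreover have "(\<Sum>i\<in>UNIV. \<alpha> i + \<beta> i) \<le> r + s"
      using that by (simp add: sum.distrib)
    ultimately show ?thesis
      unfolding polys by (intro span_base) blast
  qed
  have mon_right: "(\<lambda>x. p x * mon \<beta> x) \<in> polys (r + s)" if \<beta>: "sum \<beta> UNIV \<le> s" for \<beta>
  proof (rule span_induct[where P = "\<lambda>p. (\<lambda>x. p x * mon \<beta> x) \<in> polys (r + s)"])
    show "p \<in> span {mon \<alpha> | \<alpha>. sum \<alpha> UNIV \<le> r}"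
      using assms(1) by (simp add: polys)
    show "subspace {p. (\<lambda>x. p x * mon \<beta> x) \<in> polys (r + s)}"
      unfolding subspace_def
      by (auto simp: zero_fun_def plus_fun_def scaleR_fun_def distrib_right mult.assoc zero add scale)
  qed (use mon_mon \<beta> in auto)
  show ?thesis
  proof (rule span_induct[where P = "\<lambda>q. (\<lambda>x. p x * q x) \<in> polys (r + s)"])
    show "q \<in> span {mon \<beta> | \<beta>. sum \<beta> UNIV \<le> s}"
      using assms(2) by (simp add: polys)
    show "subspace {q. (\<lambda>x. p x * q x) \<in> polys (r + s)}"
      unfolding subspace_def
      by (auto simp: zero_fun_def plus_fun_def scaleR_fun_def distrib_left mult.left_commute zero add scale)
  qed (use mon_right in auto)
qed

lemma polys_continuous:
  assumes "p \<in> (polys r :: (real ^ 'd \<Rightarrow> real) set)"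
  shows "continuous_on A p"
proof (rule span_induct[where P = "continuous_on A"])
  show "p \<in> span {(\<lambda>x. \<Prod>i\<in>UNIV. vec_nth x i ^ \<alpha> i) | \<alpha>. (\<Sum>i\<in>UNIV. \<alpha> i) \<le> r}"
    using assms by (simp add: polys_def)
  show "subspace {p. continuous_on A (p :: real ^ 'd \<Rightarrow> real)}"
    unfolding subspace_def mem_Collect_eq zero_fun_def plus_fun_def scaleR_fun_def
    by (intro conjI ballI allI impI continuous_on_const continuous_on_add continuous_on_scaleR;
        simp)
next
  fix p :: "real ^ 'd \<Rightarrow> real"
  assume "p \<in> {(\<lambda>x. \<Prod>i\<in>UNIV. vec_nth x i ^ \<alpha> i) | \<alpha>. (\<Sum>i\<in>UNIV. \<alpha> i) \<le> r}"
  then obtain \<alpha> where p: "p = (\<lambda>x. \<Prod>i\<in>UNIV. vec_nth x i ^ \<alpha> i)"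
    by blast
  show "continuous_on A p"
    unfolding p by (intro continuous_on_prod continuous_on_power continuous_on_component continuous_on_id)
qed

text \<open>Both sides are linear in \<open>q\<close> and agree for \<open>q = \<psi> i\<close> by the Kronecker property of the nodes.\<close>

lemma lagrange_interpolation:
  fixes q :: "real ^ 'd \<Rightarrow> real"
  assumes ref: "reference_lagrange K r \<psi> \<xi>" and q: "q \<in> polys r"
  shows "q y = (\<Sum>j < dim (polys r :: (real ^ 'd \<Rightarrow> real) set). q (\<xi> j) * \<psi> j y)"
proof -
  define n where "n = dim (polys r :: (real ^ 'd \<Rightarrow> real) set)"
  define P where "P = (\<lambda>q :: real ^ 'd \<Rightarrow> real. \<forall>y. q y = (\<Sum>j<n. q (\<xi> j) * \<psi> j y))"
  have span: "span (\<psi> ` {..<n}) = polys r"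
    and delta: "\<And>i j. i < n \<Longrightarrow> j < n \<Longrightarrow> \<psi> j (\<xi> i) = (if i = j then 1 else 0)"
    using ref by (auto simp: reference_lagrange_def indexed_basis_def n_def)
  have "P q"
  proof (rule span_induct[where P = P])
    show "q \<in> span (\<psi> ` {..<n})"
      using q span by simp
    \<comment> \<open>The equation in \<open>P\<close> reproduces instances of its left-hand side, the values at the nodes,
      so it does not terminate as a rewrite rule.\<close>
    show "subspace (Collect P)"
    proof (rule subspaceI)
      show "0 \<in> Collect P" by (simp add: P_def)
    next
      fix a b assume "a \<in> Collect P" "b \<in> Collect P"
      then have "a y = (\<Sum>j<n. a (\<xi> j) * \<psi> j y)" "b y = (\<Sum>j<n. b (\<xi> j) * \<psi> j y)" for y
        unfolding P_def by blast+
      then have "a y + b y = (\<Sum>j<n. (a (\<xi> j) + b (\<xi> j)) * \<psi> j y)" for y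
        unfolding distrib_right sum.distrib by metis
      then show "a + b \<in> Collect P" unfolding P_def mem_Collect_eq plus_fun_def by blast
    next
      fix c a assume "a \<in> Collect P"
      then have "a y = (\<Sum>j<n. a (\<xi> j) * \<psi> j y)" for y
        unfolding P_def by blast
      then have "c * a y = (\<Sum>j<n. c * a (\<xi> j) * \<psi> j y)" for y
        unfolding mult.assoc sum_distrib_left[symmetric] by metis
      then show "c *\<^sub>R a \<in> Collect P"
        unfolding P_def mem_Collect_eq scaleR_fun_def real_scaleR_def by blast
    qed
  next
    fix f assume "f \<in> \<psi> ` {..<n}"
    then obtain i where i: "i < n" "f = \<psi> i" by auto
    have "(\<Sum>j<n. \<psi> i (\<xi> j) * \<psi> j y) = (\<Sum>j<n. if j = i then \<psi> j y else 0)" for y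
      using delta i by (intro sum.cong) auto
    then show "P f"
      using i by (simp only: P_def) simp
  qed
  then show ?thesis unfolding P_def n_def by blast
qed

section \<open>Integration over the mesh\<close>

text \<open>The intersection is a face of both elements and a proper face of at least one of them. A proper
  face misses the interior of its simplex, so the intersection is a convex set with empty interior.\<close>

lemma triangulation_negligible_Int:
  fixes \<M> :: "(real ^ 'd) set set"
  assumes \<M>: "triangulation \<M>" and "T \<in> \<M>" "T' \<in> \<M>" "T \<noteq> T'"
  shows "negligible (T \<inter> T')"
proof -
  have face: "(T \<inter> T') face_of T" "(T \<inter> T') face_of T'"
    using \<M> \<open>T \<in> \<M>\<close> \<open>T' \<in> \<M>\<close> unfolding triangulation_def by (metis Int_commute)+
  have convex: "convex (T \<inter> T')"
    using face(1) by (rule face_of_imp_convex)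
  have "interior (T \<inter> T') = {}"
  proof (cases "T \<inter> T' = T")
    case True
    with \<open>T \<noteq> T'\<close> have "T \<inter> T' \<noteq> T'" by auto
    then show ?thesis
      using face_of_disjoint_interior[OF face(2)] interior_subset[of "T \<inter> T'"] interior_mono[of "T \<inter> T'" T']
      by blast
  next
    case False
    then show ?thesis
      using face_of_disjoint_interior[OF face(1)] interior_subset[of "T \<inter> T'"] interior_mono[of "T \<inter> T'" T]
      by blast
  qed
  then show ?thesis
    by (simp add: negligible_convex_interior[OF convex])
qed

lemma mesh_integral:
  fixes g :: "real ^ 'd \<Rightarrow> real"
  assumes \<Omega>: "open \<Omega>" and mesh: "simplicial_mesh \<Omega> \<M>" and g: "set_integrable lebesgue \<Omega> g"
  shows "(LINT x:\<Omega>|lebesgue. g x) = (\<Sum>T\<in>\<M>. LINT x:T \<inter> \<Omega>|lebesgue. g x)"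
proof -
  have tri: "triangulation \<M>" and cover: "\<Omega> \<subseteq> \<Union>\<M>" and fin: "finite \<M>"
    and compact: "\<And>T. T \<in> \<M> \<Longrightarrow> compact T"
    using mesh closure_subset[of \<Omega>]
    by (auto simp: simplicial_mesh_def triangulation_def intro: compact_simplex)
  have meas: "T \<inter> \<Omega> \<in> sets lebesgue" if "T \<in> \<M>" for T
    using \<Omega> compact[OF that] by (auto intro!: sets.Int borel_compact)
  have "(LINT x:(\<Union>T\<in>\<M>. T \<inter> \<Omega>)|lebesgue. g x) = (\<Sum>T\<in>\<M>. LINT x:T \<inter> \<Omega>|lebesgue. g x)"
  proof (rule set_integral_finite_UN_AE[OF fin])
    fix T T' assume T: "T \<in> \<M>" "T' \<in> \<M>"
    show "AE x in lebesgue. x \<in> T \<inter> \<Omega> \<and> x \<in> T' \<inter> \<Omega> \<longrightarrow> T = T'"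
    proof (cases "T = T'")
      case False
      then have "T \<inter> T' \<in> null_sets lebesgue"
        using triangulation_negligible_Int[OF tri T] by (simp add: negligible_iff_null_sets)
      from AE_not_in[OF this] show ?thesis by eventually_elim auto
    qed simp
  next
    fix T assume "T \<in> \<M>"
    then show "set_integrable lebesgue (T \<inter> \<Omega>) g"
      using set_integrable_subset[OF g meas] by auto
  qed (use meas in auto)
  moreover have "(\<Union>T\<in>\<M>. T \<inter> \<Omega>) = \<Omega>"
    using cover by auto
  ultimately show ?thesis by simp
qed

section \<open>Integrability of products with finite element functions\<close>

text \<open>On each of the finitely many compact elements the function agrees, inside \<open>\<Omega>\<close>, with a
  polynomial.\<close>

lemma fe_space_bounded:
  assumes mesh: "simplicial_mesh \<Omega> \<M>" and f: "f \<in> fe_space \<Omega> \<M> r"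
  obtains C where "\<And>x. \<bar>f x\<bar> \<le> C"
proof -
  have "bounded (f ` (T \<inter> \<Omega>))" if T: "T \<in> \<M>" for T
  proof -
    obtain p where p: "p \<in> polys r" "\<And>x. x \<in> T \<inter> \<Omega> \<Longrightarrow> f x = p x"
      using f T by (auto simp: fe_space_def)
    have "compact T"
      using mesh T by (auto simp: simplicial_mesh_def intro: compact_simplex)
    then have "bounded (p ` T)"
      by (intro compact_imp_bounded compact_continuous_image polys_continuous[OF p(1)])
    moreover have "f ` (T \<inter> \<Omega>) \<subseteq> p ` T"
      using p(2) by auto
    ultimately show ?thesis by (rule bounded_subset)
  qed
  moreover have "finite \<M>"
    using mesh by (auto simp: simplicial_mesh_def triangulation_def)
  ultimately have "bounded (\<Union>T\<in>\<M>. f ` (T \<inter> \<Omega>))"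
    by (intro bounded_UN) auto
  moreover have "f ` \<Omega> \<subseteq> (\<Union>T\<in>\<M>. f ` (T \<inter> \<Omega>))"
    using mesh closure_subset[of \<Omega>] by (fastforce simp: simplicial_mesh_def)
  ultimately have "bounded (insert 0 (f ` \<Omega>))"
    using bounded_subset by auto
  then obtain C where C: "\<And>y. y \<in> insert 0 (f ` \<Omega>) \<Longrightarrow> \<bar>y\<bar> \<le> C"
    unfolding bounded_iff real_norm_def by blast
  have "f x \<in> insert 0 (f ` \<Omega>)" for x
    using f by (auto simp: fe_space_def)
  then show thesis
    using that C by blast
qed

text \<open>A weight remains integrable after multiplication by a bounded measurable function. The
  statement can be iterated, so that it also covers the weighted products of two basis functions in
  the system matrix.\<close>

lemma set_integrable_mult_fe_space:
  fixes g :: "real ^ 'd \<Rightarrow> real"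
  assumes \<Omega>: "open \<Omega>" and mesh: "simplicial_mesh \<Omega> \<M>" and f: "f \<in> fe_space \<Omega> \<M> r"
    and g: "set_integrable lebesgue \<Omega> g"
  shows "set_integrable lebesgue \<Omega> (\<lambda>x. g x * f x)"
proof -
  obtain C where C: "\<And>x. \<bar>f x\<bar> \<le> C"
    using fe_space_bounded[OF mesh f] by blast
  have "continuous_on \<Omega> f" "\<And>x. x \<notin> \<Omega> \<Longrightarrow> f x = 0"
    using f by (auto simp: fe_space_def)
  then have "f \<in> borel_measurable borel"
    using borel_measurable_continuous_on_indicator[of \<Omega> f] \<Omega>
    by (subst measurable_cong[of _ _ "\<lambda>x. indicator \<Omega> x *\<^sub>R f x"]) (auto simp: indicator_def)
  then have meas: "f \<in> borel_measurable lebesgue"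
    by (simp add: measurable_completion)
  have G: "integrable lebesgue (\<lambda>x. indicator \<Omega> x *\<^sub>R g x)"
    using g by (simp add: set_integrable_def)
  have "integrable lebesgue (\<lambda>x. indicator \<Omega> x *\<^sub>R g x * f x)"
  proof (rule Bochner_Integration.integrable_bound)
    show "integrable lebesgue (\<lambda>x. (indicator \<Omega> x *\<^sub>R g x) * C)"
      using G by (rule integrable_mult_left)
    show "(\<lambda>x. indicator \<Omega> x *\<^sub>R g x * f x) \<in> borel_measurable lebesgue"
      by (rule borel_measurable_times[OF borel_measurable_integrable[OF G] meas])
    show "AE x in lebesgue. norm (indicator \<Omega> x *\<^sub>R g x * f x) \<le> norm ((indicator \<Omega> x *\<^sub>R g x) * C)"
    proof (rule AE_I2)
      fix x
      have "\<bar>f x\<bar> \<le> \<bar>C\<bar>"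
        using C[of x] by linarith
      then show "norm (indicator \<Omega> x *\<^sub>R g x * f x) \<le> norm ((indicator \<Omega> x *\<^sub>R g x) * C)"
        by (simp add: abs_mult mult_left_mono)
    qed
  qed
  then show ?thesis
    by (simp add: set_integrable_def mult.assoc)
qed

section \<open>The local mass matrix as a diagonal form on the double grid\<close>

text \<open>At points of \<open>\<Omega>\<close> the continuous extension from an element is the plain value, so the
  local description of the basis functions can be used under integrals over \<open>T \<inter> \<Omega>\<close>.\<close>

lemma lagrange_fe_local:
  fixes \<Omega> :: "(real ^ 'd) set"
  assumes fe: "lagrange_fe \<Omega> \<M> K R S r \<psi> \<xi> \<phi> xn L" and T: "T \<in> \<M>"
    and n: "n = dim (polys r :: (real ^ 'd \<Rightarrow> real) set)" and N: "N = dim (fe_space \<Omega> \<M> r)"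
  shows "inj_on (L T) {..<n}" "L T ` {..<n} \<subseteq> {..<N}"
    and "\<And>i x. i < n \<Longrightarrow> x \<in> T \<inter> \<Omega> \<Longrightarrow> \<phi> (L T i) x = \<psi> i (inv_into UNIV (elem_map R S T) x)"
    and "\<And>j x. j < N \<Longrightarrow> j \<notin> L T ` {..<n} \<Longrightarrow> x \<in> T \<inter> \<Omega> \<Longrightarrow> \<phi> j x = 0"
proof -
  show "inj_on (L T) {..<n}" "L T ` {..<n} \<subseteq> {..<N}"
    using fe T by (auto simp: lagrange_fe_def Let_def n N)
next
  fix i x assume "i < n" "x \<in> T \<inter> \<Omega>"
  then have "elem_val \<Omega> T (\<phi> (L T i)) x = \<psi> i (inv_into UNIV (elem_map R S T) x)"
    using fe T by (auto simp: lagrange_fe_def Let_def n N)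
  then show "\<phi> (L T i) x = \<psi> i (inv_into UNIV (elem_map R S T) x)"
    using \<open>x \<in> T \<inter> \<Omega>\<close> by (simp add: elem_val_def)
next
  fix j x assume "j < N" "j \<notin> L T ` {..<n}" "x \<in> T \<inter> \<Omega>"
  then have "elem_val \<Omega> T (\<phi> j) x = 0"
    using fe T by (auto simp: lagrange_fe_def Let_def n N)
  then show "\<phi> j x = 0"
    using \<open>x \<in> T \<inter> \<Omega>\<close> by (simp add: elem_val_def)
qed

lemma lagrange_fe_basis_mem:
  assumes "lagrange_fe \<Omega> \<M> K R S r \<psi> \<xi> \<phi> xn L" "i < dim (fe_space \<Omega> \<M> r)"
  shows "\<phi> i \<in> fe_space \<Omega> \<M> r"
proof -
  have "span (\<phi> ` {..<dim (fe_space \<Omega> \<M> r)}) = fe_space \<Omega> \<M> r"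
    using assms(1) by (simp add: lagrange_fe_def Let_def indexed_basis_def)
  moreover have "\<phi> i \<in> span (\<phi> ` {..<dim (fe_space \<Omega> \<M> r)})"
    using assms(2) by (intro span_base) auto
  ultimately show ?thesis by simp
qed

text \<open>The double-grid quadrature rule on one element: the integrand is expanded at the nodes of
  order \<open>2 * k\<close>, where the shape functions of order \<open>k\<close> have the entries of the interpolation matrix as
  values. Since the expansion is pointwise, it is compatible with any weight \<open>m\<close>.\<close>

lemma element_integral:
  fixes \<Omega> :: "(real ^ 'd) set"
  assumes \<Omega>: "open \<Omega>" and mesh: "simplicial_mesh \<Omega> \<M>"
    and V: "lagrange_fe \<Omega> \<M> K R S k \<psi>V \<xi>V \<phi>V xV LV"
    and W: "lagrange_fe \<Omega> \<M> K R S (2 * k) \<psi>W \<xi>W \<phi>W xW LW"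
    and m: "set_integrable lebesgue \<Omega> m"
    and V_T: "V_T = dim (polys k :: (real ^ 'd \<Rightarrow> real) set)"
    and W_T: "W_T = dim (polys (2 * k) :: (real ^ 'd \<Rightarrow> real) set)"
    and T: "T \<in> \<M>" and l: "l < V_T" and p: "p < V_T"
  shows "(LINT x:T \<inter> \<Omega>|lebesgue. m x * \<phi>V (LV T l) x * \<phi>V (LV T p) x) =
    (\<Sum>j<W_T. \<psi>V l (\<xi>W j) * \<psi>V p (\<xi>W j) * (LINT x:T|lebesgue. m x * \<phi>W (LW T j) x))"
proof -
  note locV = lagrange_fe_local[OF V T V_T refl]
  note locW = lagrange_fe_local[OF W T W_T refl]
  have refW: "reference_lagrange K (2 * k) \<psi>W \<xi>W"
    using W by (simp add: lagrange_fe_def Let_def)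
  have \<psi>: "\<psi>V i \<in> polys k" if "i < V_T" for i
  proof -
    have "span (\<psi>V ` {..<V_T}) = polys k"
      using V by (simp add: lagrange_fe_def Let_def reference_lagrange_def indexed_basis_def V_T)
    moreover have "\<psi>V i \<in> span (\<psi>V ` {..<V_T})"
      using that by (intro span_base) auto
    ultimately show ?thesis by simp
  qed
  have "(\<lambda>y. \<psi>V l y * \<psi>V p y) \<in> polys (2 * k)"
    using polys_mult[OF \<psi>[OF l] \<psi>[OF p]] by (simp add: mult_2)
  note interp = lagrange_interpolation[OF refW this, folded W_T]
  have \<phi>W: "\<phi>W (LW T j) \<in> fe_space \<Omega> \<M> (2 * k)" if "j < W_T" for j
    using that locW(2) by (intro lagrange_fe_basis_mem[OF W]) auto
  have "compact T"
    using mesh T by (auto simp: simplicial_mesh_def intro: compact_simplex)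
  then have T_meas: "T \<inter> \<Omega> \<in> sets lebesgue"
    using \<Omega> by (auto intro!: sets.Int borel_compact)
  have int: "set_integrable lebesgue (T \<inter> \<Omega>) (\<lambda>x. m x * \<phi>W (LW T j) x)" if "j < W_T" for j
    by (rule set_integrable_subset[OF set_integrable_mult_fe_space[OF \<Omega> mesh \<phi>W[OF that] m] T_meas]) auto
  have ext: "(LINT x:T \<inter> \<Omega>|lebesgue. m x * \<phi>W (LW T j) x) = (LINT x:T|lebesgue. m x * \<phi>W (LW T j) x)"
    if "j < W_T" for j
    using \<phi>W[OF that] unfolding set_lebesgue_integral_def
    by (intro Bochner_Integration.integral_cong) (auto simp: indicator_def fe_space_def)
  have pointwise: "m x * \<phi>V (LV T l) x * \<phi>V (LV T p) x =
      (\<Sum>j<W_T. \<psi>V l (\<xi>W j) * \<psi>V p (\<xi>W j) * (m x * \<phi>W (LW T j) x))" if x: "x \<in> T \<inter> \<Omega>" for x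
  proof -
    let ?y = "inv_into UNIV (elem_map R S T) x"
    have "m x * \<phi>V (LV T l) x * \<phi>V (LV T p) x = m x * (\<psi>V l ?y * \<psi>V p ?y)"
      using locV(3)[OF l x] locV(3)[OF p x] by simp
    also have "\<dots> = m x * (\<Sum>j<W_T. \<psi>V l (\<xi>W j) * \<psi>V p (\<xi>W j) * \<psi>W j ?y)"
      by (simp only: interp[of ?y])
    also have "\<dots> = (\<Sum>j<W_T. \<psi>V l (\<xi>W j) * \<psi>V p (\<xi>W j) * (m x * \<phi>W (LW T j) x))"
      unfolding sum_distrib_left using locW(3)[OF _ x] by (intro sum.cong) (auto simp: mult_ac)
    finally show ?thesis .
  qed
  have "(LINT x:T \<inter> \<Omega>|lebesgue. m x * \<phi>V (LV T l) x * \<phi>V (LV T p) x) =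
      (LINT x:T \<inter> \<Omega>|lebesgue. \<Sum>j<W_T. \<psi>V l (\<xi>W j) * \<psi>V p (\<xi>W j) * (m x * \<phi>W (LW T j) x))"
    using T_meas pointwise by (intro set_lebesgue_integral_cong) auto
  also have "\<dots> = (\<Sum>j<W_T. LINT x:T \<inter> \<Omega>|lebesgue. \<psi>V l (\<xi>W j) * \<psi>V p (\<xi>W j) * (m x * \<phi>W (LW T j) x))"
    using int unfolding set_lebesgue_integral_def set_integrable_def scaleR_sum_right
    by (intro Bochner_Integration.integral_sum)
       (simp add: mult.left_commute[of "indicator _ _"])
  also have "\<dots> = (\<Sum>j<W_T. \<psi>V l (\<xi>W j) * \<psi>V p (\<xi>W j) * (LINT x:T|lebesgue. m x * \<phi>W (LW T j) x))"
    using ext by (intro sum.cong) auto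
  finally show ?thesis .
qed

section \<open>Bilinear forms in coordinates and assembly\<close>

lemma mult_mat_vec_scalar_prod:
  assumes "A \<in> carrier_mat n n'" "u \<in> carrier_vec n'" "v \<in> carrier_vec n"
  shows "(A *\<^sub>v u) \<bullet> v = (\<Sum>i<n. \<Sum>j<n'. A $$ (i, j) * vec_index u j * vec_index v i)"
  using assms
  by (auto simp: scalar_prod_def sum_distrib_right atLeast0LessThan intro!: sum.cong)

text \<open>Moving the transpose to the other factor gives the form of \<open>D\<close> at \<open>B u\<close> and \<open>B v\<close>, whose
  coordinate expansion is the claimed sum.\<close>

lemma congruence_scalar_prod:
  fixes B D :: "real mat"
  assumes B: "B \<in> carrier_mat n n'" and D: "D \<in> carrier_mat n n"
    and u: "u \<in> carrier_vec n'" and v: "v \<in> carrier_vec n'"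
  shows "((transpose_mat B * D * B) *\<^sub>v u) \<bullet> v =
    (\<Sum>i<n. \<Sum>j<n. \<Sum>p<n'. \<Sum>l<n'.
      D $$ (i, j) * B $$ (j, l) * vec_index u l * B $$ (i, p) * vec_index v p)"
proof -
  have Bu: "B *\<^sub>v u \<in> carrier_vec n" and Bv: "B *\<^sub>v v \<in> carrier_vec n"
    using B u v by auto
  have entry: "vec_index (B *\<^sub>v w) j = (\<Sum>l<n'. B $$ (j, l) * vec_index w l)"
    if "w \<in> carrier_vec n'" "j < n" for w j
    using B that by (auto simp: scalar_prod_def atLeast0LessThan intro!: sum.cong)
  have "(transpose_mat B * D * B) *\<^sub>v u = transpose_mat B *\<^sub>v (D *\<^sub>v (B *\<^sub>v u))"
    using B D u by (simp add: assoc_mult_mat_vec[of _ n' n _ n'] assoc_mult_mat_vec[of _ n' n _ n])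
  also have "\<dots> \<bullet> v = (D *\<^sub>v (B *\<^sub>v u)) \<bullet> (B *\<^sub>v v)"
    using transpose_vec_mult_scalar[OF B v, of "D *\<^sub>v (B *\<^sub>v u)"] D Bu by auto
  also have "\<dots> = (\<Sum>i<n. \<Sum>j<n. D $$ (i, j) * vec_index (B *\<^sub>v u) j * vec_index (B *\<^sub>v v) i)"
    by (rule mult_mat_vec_scalar_prod[OF D Bu Bv])
  also have "\<dots> = (\<Sum>i<n. \<Sum>j<n. \<Sum>p<n'. \<Sum>l<n'.
      D $$ (i, j) * B $$ (j, l) * vec_index u l * B $$ (i, p) * vec_index v p)"
  proof (intro sum.cong refl)
    fix i j assume "i \<in> {..<n}" "j \<in> {..<n}"
    then show "D $$ (i, j) * vec_index (B *\<^sub>v u) j * vec_index (B *\<^sub>v v) i =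
      (\<Sum>p<n'. \<Sum>l<n'. D $$ (i, j) * B $$ (j, l) * vec_index u l * B $$ (i, p) * vec_index v p)"
      by (simp add: entry u v sum_distrib_left sum_distrib_right mult.assoc)
  qed
  finally show ?thesis .
qed

text \<open>Passage from global to local degrees of freedom: \<open>L\<close> will be the local-to-global map of an
  element and \<open>g\<close> a quantity that vanishes for basis functions not living on it.\<close>

lemma sum_reindex_support:
  fixes g :: "nat \<Rightarrow> real"
  assumes "inj_on L {..<n}" "L ` {..<n} \<subseteq> {..<N}"
    and "\<And>i. i < N \<Longrightarrow> i \<notin> L ` {..<n} \<Longrightarrow> g i = 0"
  shows "(\<Sum>i<N. g i) = (\<Sum>l<n. g (L l))"
proof -
  have "(\<Sum>i<N. g i) = (\<Sum>i\<in>L ` {..<n}. g i)"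
    using assms by (intro sum.mono_neutral_right) auto
  then show ?thesis
    by (simp add: sum.reindex[OF assms(1)])
qed


theorem theorem5:
  fixes \<Omega> K :: "(real ^ 'd) set" and \<M> :: "(real ^ 'd) set set"
    and R :: "(real ^ 'd) set \<Rightarrow> real ^ 'd ^ 'd" and S :: "(real ^ 'd) set \<Rightarrow> real ^ 'd"
    and k dim_V V_T W_T :: nat
    and \<psi>V \<psi>W \<phi>V \<phi>W :: "nat \<Rightarrow> real ^ 'd \<Rightarrow> real"
    and \<xi>V \<xi>W xV xW :: "nat \<Rightarrow> real ^ 'd"
    and LV LW :: "(real ^ 'd) set \<Rightarrow> nat \<Rightarrow> nat"
    and m :: "real ^ 'd \<Rightarrow> real"
    and A B :: "real mat" and A_T :: "(real ^ 'd) set \<Rightarrow> real mat"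
  assumes d: "CARD('d) = 2 \<or> CARD('d) = 3"
    and \<Omega>: "open \<Omega>" "bounded \<Omega>"
    and mesh: "simplicial_mesh \<Omega> \<M>"
    and ref: "reference_maps \<M> K R S"
    and k: "k \<ge> 1"
    and V: "lagrange_fe \<Omega> \<M> K R S k \<psi>V \<xi>V \<phi>V xV LV"
    and W: "lagrange_fe \<Omega> \<M> K R S (2 * k) \<psi>W \<xi>W \<phi>W xW LW"
    and m_int: "set_integrable lebesgue \<Omega> m"
    and m_pos: "\<exists>c>0. \<forall>x\<in>\<Omega>. c \<le> m x"
    and dim_V: "dim_V = dim (fe_space \<Omega> \<M> k)"
    and V_T: "V_T = dim (polys k :: (real ^ 'd \<Rightarrow> real) set)"
    and W_T: "W_T = dim (polys (2 * k) :: (real ^ 'd \<Rightarrow> real) set)"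
    and A: "A = system_matrix \<Omega> m dim_V \<phi>V"
    and A_T: "\<And>T. T \<in> \<M> \<Longrightarrow> A_T T = dogip_matrix m W_T \<phi>W LW T"
    and B: "B = interpolation_matrix W_T V_T \<psi>V \<xi>W"
  shows "\<forall>u \<in> carrier_vec dim_V. \<forall>v \<in> carrier_vec dim_V.
    (A *\<^sub>v u) \<bullet> v =
      (\<Sum>T\<in>\<M>. ((transpose_mat B * A_T T * B) *\<^sub>v local_dofs V_T LV u T) \<bullet> local_dofs V_T LV v T) \<and>
    (\<Sum>T\<in>\<M>. ((transpose_mat B * A_T T * B) *\<^sub>v local_dofs V_T LV u T) \<bullet> local_dofs V_T LV v T) =
      (\<Sum>T\<in>\<M>. \<Sum>i<W_T. \<Sum>j<W_T. \<Sum>p<V_T. \<Sum>l<V_T.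
         A_T T $$ (i, j) * B $$ (j, l) * vec_index (local_dofs V_T LV u T) l *
         B $$ (i, p) * vec_index (local_dofs V_T LV v T) p)"
proof (intro ballI conjI)
  fix u v :: "real vec"
  assume u: "u \<in> carrier_vec dim_V" and v: "v \<in> carrier_vec dim_V"
  define I where "I T j i = (LINT x:T \<inter> \<Omega>|lebesgue. m x * \<phi>V j x * \<phi>V i x)" for T i j
  have B_carrier: "B \<in> carrier_mat W_T V_T"
    by (simp add: B interpolation_matrix_def)
  have quadruple: "((transpose_mat B * A_T T * B) *\<^sub>v local_dofs V_T LV u T) \<bullet> local_dofs V_T LV v T =
      (\<Sum>i<W_T. \<Sum>j<W_T. \<Sum>p<V_T. \<Sum>l<V_T.
         A_T T $$ (i, j) * B $$ (j, l) * vec_index (local_dofs V_T LV u T) l *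
         B $$ (i, p) * vec_index (local_dofs V_T LV v T) p)" if "T \<in> \<M>" for T
    by (rule congruence_scalar_prod[OF B_carrier])
       (auto simp: A_T[OF that] dogip_matrix_def local_dofs_def)
  then show "(\<Sum>T\<in>\<M>. ((transpose_mat B * A_T T * B) *\<^sub>v local_dofs V_T LV u T) \<bullet> local_dofs V_T LV v T) =
      (\<Sum>T\<in>\<M>. \<Sum>i<W_T. \<Sum>j<W_T. \<Sum>p<V_T. \<Sum>l<V_T.
         A_T T $$ (i, j) * B $$ (j, l) * vec_index (local_dofs V_T LV u T) l *
         B $$ (i, p) * vec_index (local_dofs V_T LV v T) p)"
    by simp
  have entry: "A $$ (i, j) = (\<Sum>T\<in>\<M>. I T j i)" if "i < dim_V" "j < dim_V" for i j
  proof -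
    have "\<phi>V i \<in> fe_space \<Omega> \<M> k" "\<phi>V j \<in> fe_space \<Omega> \<M> k"
      using that lagrange_fe_basis_mem[OF V] by (auto simp: dim_V)
    then have "set_integrable lebesgue \<Omega> (\<lambda>x. m x * \<phi>V j x * \<phi>V i x)"
      by (intro set_integrable_mult_fe_space[OF \<Omega>(1) mesh] m_int)
    from mesh_integral[OF \<Omega>(1) mesh this] show ?thesis
      using that by (simp add: A system_matrix_def I_def)
  qed
  have element: "(\<Sum>i<dim_V. \<Sum>j<dim_V. I T j i * vec_index u j * vec_index v i) =
      ((transpose_mat B * A_T T * B) *\<^sub>v local_dofs V_T LV u T) \<bullet> local_dofs V_T LV v T"
    if T: "T \<in> \<M>" for T
  proof -
    note loc = lagrange_fe_local[OF V T V_T dim_V]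
    have I_zero: "I T j i = 0" if "j < dim_V \<and> j \<notin> LV T ` {..<V_T} \<or> i < dim_V \<and> i \<notin> LV T ` {..<V_T}" for i j
    proof -
      have "indicator (T \<inter> \<Omega>) x *\<^sub>R (m x * \<phi>V j x * \<phi>V i x) = 0" for x
        using that loc(4) by (cases "x \<in> T \<inter> \<Omega>") auto
      then show ?thesis unfolding I_def set_lebesgue_integral_def by (simp only: integral_zero)
    qed
    have "(\<Sum>i<dim_V. \<Sum>j<dim_V. I T j i * vec_index u j * vec_index v i) =
        (\<Sum>p<V_T. \<Sum>j<dim_V. I T j (LV T p) * vec_index u j * vec_index v (LV T p))"
      by (intro sum_reindex_support loc(1,2)) (simp add: I_zero)
    also have "\<dots> = (\<Sum>p<V_T. \<Sum>l<V_T. I T (LV T l) (LV T p) * vec_index u (LV T l) * vec_index v (LV T p))"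
      by (intro sum.cong refl sum_reindex_support loc(1,2)) (simp add: I_zero)
    also have "\<dots> = (\<Sum>p<V_T. \<Sum>l<V_T. \<Sum>j<W_T.
        A_T T $$ (j, j) * B $$ (j, l) * vec_index (local_dofs V_T LV u T) l *
        B $$ (j, p) * vec_index (local_dofs V_T LV v T) p)"
    proof (intro sum.cong refl)
      fix p l assume pl: "p \<in> {..<V_T}" "l \<in> {..<V_T}"
      then have "I T (LV T l) (LV T p) =
          (\<Sum>j<W_T. \<psi>V l (\<xi>W j) * \<psi>V p (\<xi>W j) * (LINT x:T|lebesgue. m x * \<phi>W (LW T j) x))"
        unfolding I_def by (intro element_integral[OF \<Omega>(1) mesh V W m_int V_T W_T T]) auto
      then show "I T (LV T l) (LV T p) * vec_index u (LV T l) * vec_index v (LV T p) =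
        (\<Sum>j<W_T. A_T T $$ (j, j) * B $$ (j, l) * vec_index (local_dofs V_T LV u T) l *
          B $$ (j, p) * vec_index (local_dofs V_T LV v T) p)"
        using pl by (simp add: A_T[OF T] B dogip_matrix_def interpolation_matrix_def local_dofs_def
            sum_distrib_left sum_distrib_right mult_ac)
    qed
    also have "\<dots> = (\<Sum>p<V_T. \<Sum>j<W_T. \<Sum>l<V_T.
        A_T T $$ (j, j) * B $$ (j, l) * vec_index (local_dofs V_T LV u T) l *
        B $$ (j, p) * vec_index (local_dofs V_T LV v T) p)"
      by (intro sum.cong refl sum.swap)
    also have "\<dots> = (\<Sum>i<W_T. \<Sum>p<V_T. \<Sum>l<V_T.
        A_T T $$ (i, i) * B $$ (i, l) * vec_index (local_dofs V_T LV u T) l *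
        B $$ (i, p) * vec_index (local_dofs V_T LV v T) p)"
      by (rule sum.swap)
    also have "\<dots> = (\<Sum>i<W_T. \<Sum>j<W_T. \<Sum>p<V_T. \<Sum>l<V_T.
        A_T T $$ (i, j) * B $$ (j, l) * vec_index (local_dofs V_T LV u T) l *
        B $$ (i, p) * vec_index (local_dofs V_T LV v T) p)"
    proof (rule sum.cong[OF refl])
      fix i assume i: "i \<in> {..<W_T}"
      \<comment> \<open>The DoGIP matrix is diagonal, so only \<open>j = i\<close> contributes.\<close>
      let ?g = "\<lambda>j. \<Sum>p<V_T. \<Sum>l<V_T.
        A_T T $$ (i, j) * B $$ (j, l) * vec_index (local_dofs V_T LV u T) l *
        B $$ (i, p) * vec_index (local_dofs V_T LV v T) p"
      have "?g j = 0" if "j \<in> {..<W_T} - {i}" for j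
        using that i by (simp add: A_T[OF T] dogip_matrix_def)
      then have "sum ?g {..<W_T} = sum ?g {i}"
        using i by (intro sum.mono_neutral_right) auto
      then show "?g i = sum ?g {..<W_T}" by simp
    qed
    finally show ?thesis
      using quadruple[OF T] by simp
  qed
  have "(A *\<^sub>v u) \<bullet> v = (\<Sum>i<dim_V. \<Sum>j<dim_V. A $$ (i, j) * vec_index u j * vec_index v i)"
    using u v by (intro mult_mat_vec_scalar_prod) (auto simp: A system_matrix_def)
  also have "\<dots> = (\<Sum>i<dim_V. \<Sum>j<dim_V. \<Sum>T\<in>\<M>. I T j i * vec_index u j * vec_index v i)"
    by (simp add: entry sum_distrib_right)
  also have "\<dots> = (\<Sum>i<dim_V. \<Sum>T\<in>\<M>. \<Sum>j<dim_V. I T j i * vec_index u j * vec_index v i)"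
    by (intro sum.cong refl sum.swap)
  also have "\<dots> = (\<Sum>T\<in>\<M>. \<Sum>i<dim_V. \<Sum>j<dim_V. I T j i * vec_index u j * vec_index v i)"
    by (rule sum.swap)
  also have "\<dots> = (\<Sum>T\<in>\<M>. ((transpose_mat B * A_T T * B) *\<^sub>v local_dofs V_T LV u T) \<bullet> local_dofs V_T LV v T)"
    by (intro sum.cong refl element)
  finally show "(A *\<^sub>v u) \<bullet> v =
      (\<Sum>T\<in>\<M>. ((transpose_mat B * A_T T * B) *\<^sub>v local_dofs V_T LV u T) \<bullet> local_dofs V_T LV v T)" .
qed

end
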